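(* Let $\mathcal{F}$ be a free filter on $\mathbb{N}$ that is a p-filter. If $\mathcal{F}$ is diagonal and block-respecting, then $\mathcal{F}$ is weak $\ell_1$ complete.
   Context: A filter on $\mathbb{N}$ is free if it contains all subsets of $\mathbb{N}$ with finite complement. A sequence $(x_n)_{n\in\mathbb{N}}$ in a topological space $\mathcal{F}$-converges to $x$ if $\{n: x_n\in U\}\in\mathcal{F}$ for every neighborhood $U$ of $x$. A set $I\subset\mathbb{N}$ is $\mathcal{F}$-stationary if $I\cap A\neq\emptyset$ for every $A\in\mathcal{F}$; $\mathcal{F}^*$ denotes the collection of all $\mathcal{F}$-stationary sets. For $I\in\mathcal{F}^*$ the trace of $\mathcal{F}$ on $I$ is the filter $\{A\cap I: A\in\mathcal{F}\}$ on $I$. $\mathcal{F}$ is a p-filter (paper filter) if for every $I\in\mathcal{F}^*$ the trace of $\mathcal{F}$ on $I$ is not an ultrafilter on $I$. $\mathcal{F}$ is diagonal if for every decreasing sequence $A_1\supset A_2\supset\cdots$ of elements of $\mathcal{F}$ and every $I\in\mathcal{F}^*$ there is $J\in\mathcal{F}^*$, $J\subset I$, such that $|J\setminus A_n|<\infty$ for all $n\in\mathbb{N}$. A blocking of an infinite set $I\subset\mathbb{N}$ is a partition $D=\{D_k\}_{k\in\mathbb{N}}$ of $I$ into pairwise disjoint non-empty finite subsets. $\mathcal{F}$ is block-respecting if for every $I\in\mathcal{F}^*$ and every blocking $D=\{D_k\}_{k\in\mathbb{N}}$ of $I$ there is $J\in\mathcal{F}^*$, $J\subset I$, such that $|J\cap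 D_k|=1$ for all $k$. The space $\ell_1$ is the real Banach space of absolutely summable sequences, regarded as a subspace of its bidual $\ell_1^{**}$ via the canonical embedding. $\mathcal{F}$ is weak $\ell_1$ complete (a WC1-filter) if for every norm-bounded sequence $(x_n)\subset\ell_1$ that $\mathcal{F}$-converges in the topology $\sigma(\ell_1^{**},\ell_1^{*})$ to some $x\in\ell_1^{**}$, the limit $x$ in fact belongs to $\ell_1$. *)

theory Defs
  imports "HOL-Analysis.Analysis"
begin

section \<open>Filters on the natural numbers\<close>

text \<open>
  Filters are taken from the library type \<^typ>\<open>nat filter\<close>; a set \<open>A\<close> belongs to \<open>F\<close> iff
  \<open>eventually (\<lambda>n. n \<in> A) F\<close>. The type also contains the improper filter \<open>bot\<close>, which is not
  a filter in the usual sense and has to be excluded by an assumption \<open>F \<noteq> bot\<close>.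
\<close>

definition filter_sets :: "'a filter \<Rightarrow> 'a set set" where
  "filter_sets F = {A. eventually (\<lambda>n. n \<in> A) F}"

definition free_filter :: "nat filter \<Rightarrow> bool" where
  "free_filter F \<longleftrightarrow> (\<forall>A. finite (- A) \<longrightarrow> A \<in> filter_sets F)"

definition stationary :: "nat filter \<Rightarrow> nat set set" where
  "stationary F = {I. \<forall>A\<in>filter_sets F. I \<inter> A \<noteq> {}}"

text \<open>
  The trace of a filter lives on a subset \<open>I\<close> of the type, so it and the notion of an ultrafilter
  on \<open>I\<close> are rendered by systems of subsets of \<open>I\<close>.
\<close>

definition filter_on :: "'a set \<Rightarrow> 'a set set \<Rightarrow> bool" where
  "filter_on I G \<longleftrightarrow>
     G \<subseteq> Pow I \<and> I \<in> G \<and> {} \<notin> G \<and>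
     (\<forall>A\<in>G. \<forall>B\<in>G. A \<inter> B \<in> G) \<and>
     (\<forall>A\<in>G. \<forall>B. A \<subseteq> B \<and> B \<subseteq> I \<longrightarrow> B \<in> G)"

definition ultrafilter_on :: "'a set \<Rightarrow> 'a set set \<Rightarrow> bool" where
  "ultrafilter_on I G \<longleftrightarrow> filter_on I G \<and> (\<forall>H. filter_on I H \<and> G \<subseteq> H \<longrightarrow> H = G)"

definition trace_filter :: "'a filter \<Rightarrow> 'a set \<Rightarrow> 'a set set" where
  "trace_filter F I = {A \<inter> I |A. A \<in> filter_sets F}"

definition p_filter :: "nat filter \<Rightarrow> bool" where
  "p_filter F \<longleftrightarrow> (\<forall>I\<in>stationary F. \<not> ultrafilter_on I (trace_filter F I))"

definition diagonal_filter :: "nat filter \<Rightarrow> bool" where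
  "diagonal_filter F \<longleftrightarrow>
     (\<forall>A :: nat \<Rightarrow> nat set. decseq A \<and> (\<forall>n. A n \<in> filter_sets F) \<longrightarrow>
        (\<forall>I\<in>stationary F. \<exists>J\<in>stationary F. J \<subseteq> I \<and> (\<forall>n. finite (J - A n))))"

definition blocking :: "nat set \<Rightarrow> (nat \<Rightarrow> nat set) \<Rightarrow> bool" where
  "blocking I D \<longleftrightarrow>
     infinite I \<and> disjoint_family D \<and> (\<forall>k. finite (D k) \<and> D k \<noteq> {}) \<and> (\<Union>k. D k) = I"

definition block_respecting :: "nat filter \<Rightarrow> bool" where
  "block_respecting F \<longleftrightarrow>
     (\<forall>I\<in>stationary F. \<forall>D. blocking I D \<longrightarrow>
        (\<exists>J\<in>stationary F. J \<subseteq> I \<and> (\<forall>k. card (J \<inter> D k) = 1)))"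

lemma filter_on_trace_filter:
  assumes "I \<in> stationary F"
  shows "filter_on I (trace_filter F I)"
  unfolding filter_on_def
proof (intro conjI ballI allI impI)
  show "trace_filter F I \<subseteq> Pow I"
    by (auto simp: trace_filter_def)
  show "I \<in> trace_filter F I"
    unfolding trace_filter_def filter_sets_def by (auto intro!: exI[of _ UNIV])
  show "{} \<notin> trace_filter F I"
    using assms unfolding trace_filter_def stationary_def by fastforce
next
  fix A B assume "A \<in> trace_filter F I" "B \<in> trace_filter F I"
  then obtain A' B' where "A = A' \<inter> I" "B = B' \<inter> I" "A' \<in> filter_sets F" "B' \<in> filter_sets F"
    by (auto simp: trace_filter_def)
  then show "A \<inter> B \<in> trace_filter F I"
    unfolding trace_filter_def filter_sets_def
    by (auto intro!: exI[of _ "A' \<inter> B'"] eventually_conj)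
next
  fix A B assume "A \<in> trace_filter F I" "A \<subseteq> B \<and> B \<subseteq> I"
  then obtain A' where "A = A' \<inter> I" "A' \<in> filter_sets F" "A \<subseteq> B" "B \<subseteq> I"
    by (auto simp: trace_filter_def)
  then show "B \<in> trace_filter F I"
    unfolding trace_filter_def filter_sets_def
    by (auto intro!: exI[of _ "A' \<union> B"] elim: eventually_mono)
qed

section \<open>The Banach space of absolutely summable real sequences\<close>

typedef l1 = "{f :: nat \<Rightarrow> real. summable (\<lambda>n. \<bar>f n\<bar>)}"
  morphisms l1_nth Abs_l1
  by (rule exI[of _ "\<lambda>_. 0"]) simp

setup_lifting type_definition_l1

lemma summable_l1_nth: "summable (\<lambda>n. \<bar>l1_nth x n\<bar>)"
  using l1_nth[of x] by simp

instantiation l1 :: real_normed_vector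
begin

lift_definition norm_l1 :: "l1 \<Rightarrow> real" is "\<lambda>f. \<Sum>n. \<bar>f n\<bar>" .

lift_definition zero_l1 :: l1 is "\<lambda>_. 0" by simp

lift_definition plus_l1 :: "l1 \<Rightarrow> l1 \<Rightarrow> l1" is "\<lambda>f g n. f n + g n"
  subgoal for f g
    by (rule summable_comparison_test'[OF summable_add[of "\<lambda>n. \<bar>f n\<bar>" "\<lambda>n. \<bar>g n\<bar>"], of 0])
      (auto intro: abs_triangle_ineq)
  done

lift_definition minus_l1 :: "l1 \<Rightarrow> l1 \<Rightarrow> l1" is "\<lambda>f g n. f n - g n"
  subgoal for f g
    by (rule summable_comparison_test'[OF summable_add[of "\<lambda>n. \<bar>f n\<bar>" "\<lambda>n. \<bar>g n\<bar>"], of 0])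
      (auto intro: abs_triangle_ineq4)
  done

lift_definition uminus_l1 :: "l1 \<Rightarrow> l1" is "\<lambda>f n. - f n" by simp

lift_definition scaleR_l1 :: "real \<Rightarrow> l1 \<Rightarrow> l1" is "\<lambda>r f n. r * f n"
  by (simp add: abs_mult summable_mult)

definition dist_l1 :: "l1 \<Rightarrow> l1 \<Rightarrow> real" where
  "dist_l1 x y = norm (x - y)"

definition sgn_l1 :: "l1 \<Rightarrow> l1" where
  "sgn_l1 x = inverse (norm x) *\<^sub>R x"

definition uniformity_l1 :: "(l1 \<times> l1) filter" where
  "uniformity_l1 = (INF e\<in>{0<..}. principal {(x, y). dist x y < e})"

definition open_l1 :: "l1 set \<Rightarrow> bool" where
  "open_l1 S \<longleftrightarrow> (\<forall>x\<in>S. \<forall>\<^sub>F (x', y) in uniformity. x' = x \<longrightarrow> y \<in> S)"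

instance
proof
  fix x y z :: l1 and a b :: real
  show "dist x y = norm (x - y)" by (rule dist_l1_def)
  show "sgn x = inverse (norm x) *\<^sub>R x" by (rule sgn_l1_def)
  show "(uniformity :: (l1 \<times> l1) filter) = (INF e\<in>{0<..}. principal {(x, y). dist x y < e})"
    by (rule uniformity_l1_def)
  show "x + y + z = x + (y + z)" by transfer (simp add: add.assoc)
  show "x + y = y + x" by transfer (simp add: add.commute)
  show "0 + x = x" by transfer simp
  show "- x + x = 0" by transfer simp
  show "x - y = x + - y" by transfer simp
  show "a *\<^sub>R (x + y) = a *\<^sub>R x + a *\<^sub>R y" by transfer (simp add: algebra_simps)
  show "(a + b) *\<^sub>R x = a *\<^sub>R x + b *\<^sub>R x" by transfer (simp add: algebra_simps)
  show "a *\<^sub>R b *\<^sub>R x = (a * b) *\<^sub>R x" by transfer (simp add: algebra_simps)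
  show "1 *\<^sub>R x = x" by transfer simp
  show "norm x = 0 \<longleftrightarrow> x = 0"
    by transfer (auto simp: suminf_eq_zero_iff fun_eq_iff)
  show "norm (a *\<^sub>R x) = \<bar>a\<bar> * norm x"
    by transfer (simp add: abs_mult suminf_mult)
  show "norm (x + y) \<le> norm x + norm y"
  proof transfer
    fix f g :: "nat \<Rightarrow> real"
    assume f: "summable (\<lambda>n. \<bar>f n\<bar>)" and g: "summable (\<lambda>n. \<bar>g n\<bar>)"
    have "summable (\<lambda>n. \<bar>f n + g n\<bar>)"
      by (rule summable_comparison_test'[OF summable_add[OF f g]]) (auto intro: abs_triangle_ineq)
    then have "(\<Sum>n. \<bar>f n + g n\<bar>) \<le> (\<Sum>n. \<bar>f n\<bar> + \<bar>g n\<bar>)"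
      by (intro suminf_le summable_add f g) (auto intro: abs_triangle_ineq)
    then show "(\<Sum>n. \<bar>f n + g n\<bar>) \<le> (\<Sum>n. \<bar>f n\<bar>) + (\<Sum>n. \<bar>g n\<bar>)"
      by (simp add: suminf_add[OF f g])
  qed
next
  fix S :: "l1 set"
  show "open S \<longleftrightarrow> (\<forall>x\<in>S. \<forall>\<^sub>F (x', y) in uniformity. x' = x \<longrightarrow> y \<in> S)"
    by (rule open_l1_def)
qed

end

lemma sum_abs_l1_nth_le_norm: "(\<Sum>n<N. \<bar>l1_nth x n\<bar>) \<le> norm x"
  unfolding norm_l1.rep_eq by (rule sum_le_suminf) (auto intro: summable_l1_nth)

lemma abs_l1_nth_le_norm: "\<bar>l1_nth x n\<bar> \<le> norm x"
proof -
  have "0 \<le> (\<Sum>k<n. \<bar>l1_nth x k\<bar>)" by (rule sum_nonneg) simp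
  moreover have "(\<Sum>k<n. \<bar>l1_nth x k\<bar>) + \<bar>l1_nth x n\<bar> \<le> norm x"
    using sum_abs_l1_nth_le_norm[of x "Suc n"] by simp
  ultimately show ?thesis by linarith
qed

instance l1 :: banach
proof
  fix X :: "nat \<Rightarrow> l1"
  assume X: "Cauchy X"
  have "Cauchy (\<lambda>m. l1_nth (X m) n)" for n
  proof (rule metric_CauchyI)
    fix e :: real assume "0 < e"
    with X obtain M where "\<forall>m\<ge>M. \<forall>k\<ge>M. dist (X m) (X k) < e" unfolding Cauchy_def by blast
    moreover have "dist (l1_nth (X m) n) (l1_nth (X k) n) \<le> dist (X m) (X k)" for m k
      using abs_l1_nth_le_norm[of "X m - X k" n] by (simp add: dist_norm minus_l1.rep_eq)
    ultimately show "\<exists>M. \<forall>m\<ge>M. \<forall>k\<ge>M. dist (l1_nth (X m) n) (l1_nth (X k) n) < e"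
      by (meson le_less_trans)
  qed
  then have "\<forall>n. \<exists>y. (\<lambda>m. l1_nth (X m) n) \<longlonglongrightarrow> y"
    by (simp add: Cauchy_convergent_iff convergent_def)
  then have "\<exists>f. \<forall>n. (\<lambda>m. l1_nth (X m) n) \<longlonglongrightarrow> f n"
    by (rule choice)
  then obtain f where f: "\<And>n. (\<lambda>m. l1_nth (X m) n) \<longlonglongrightarrow> f n" by blast
  have tail: "\<exists>M. \<forall>m\<ge>M. \<forall>N. (\<Sum>n<N. \<bar>l1_nth (X m) n - f n\<bar>) \<le> e" if "0 < e" for e :: real
  proof -
    from X that obtain M where M: "\<And>m k. m \<ge> M \<Longrightarrow> k \<ge> M \<Longrightarrow> dist (X m) (X k) < e"
      unfolding Cauchy_def by blast
    have "(\<Sum>n<N. \<bar>l1_nth (X m) n - f n\<bar>) \<le> e" if m: "m \<ge> M" for m N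
    proof (rule tendsto_upperbound)
      show "(\<lambda>k. \<Sum>n<N. \<bar>l1_nth (X m) n - l1_nth (X k) n\<bar>)
              \<longlonglongrightarrow> (\<Sum>n<N. \<bar>l1_nth (X m) n - f n\<bar>)"
        by (intro tendsto_intros f)
      have "(\<Sum>n<N. \<bar>l1_nth (X m) n - l1_nth (X k) n\<bar>) \<le> e" if "k \<ge> M" for k
        using sum_abs_l1_nth_le_norm[of "X m - X k" N] M[OF m that]
        by (simp add: dist_norm minus_l1.rep_eq)
      then show "\<forall>\<^sub>F k in sequentially. (\<Sum>n<N. \<bar>l1_nth (X m) n - l1_nth (X k) n\<bar>) \<le> e"
        by (auto simp: eventually_sequentially)
    qed simp
    then show ?thesis by blast
  qed
  have diff: "summable (\<lambda>n. \<bar>l1_nth (X m) n - f n\<bar>)"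
    if "\<forall>N. (\<Sum>n<N. \<bar>l1_nth (X m) n - f n\<bar>) \<le> e" for m e
    using that by (intro summableI_nonneg_bounded[of _ e]) auto
  obtain M where "\<forall>N. (\<Sum>n<N. \<bar>l1_nth (X M) n - f n\<bar>) \<le> 1"
    using tail[of 1] by auto
  from summable_add[OF summable_l1_nth[of "X M"] diff[OF this]] have "summable (\<lambda>n. \<bar>f n\<bar>)"
    by (rule summable_comparison_test'[where N = 0]) auto
  then have L: "l1_nth (Abs_l1 f) = f"
    by (simp add: Abs_l1_inverse)
  have "X \<longlonglongrightarrow> Abs_l1 f"
  proof (rule metric_LIMSEQ_I)
    fix e :: real assume e: "0 < e"
    then obtain M where M: "\<forall>m\<ge>M. \<forall>N. (\<Sum>n<N. \<bar>l1_nth (X m) n - f n\<bar>) \<le> e / 2"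
      using tail[of "e / 2"] by auto
    have "dist (X m) (Abs_l1 f) < e" if "m \<ge> M" for m
    proof -
      have "(\<Sum>n. \<bar>l1_nth (X m) n - f n\<bar>) \<le> e / 2"
        using M that by (intro suminf_le_const diff[of m "e / 2"]) blast+
      with e show ?thesis
        by (simp add: dist_norm norm_l1.rep_eq minus_l1.rep_eq L)
    qed
    then show "\<exists>M. \<forall>m\<ge>M. dist (X m) (Abs_l1 f) < e" by blast
  qed
  then show "convergent X" by (auto simp: convergent_def)
qed

section \<open>The bidual\<close>

type_synonym 'a dual = "'a \<Rightarrow>\<^sub>L real"

lift_definition canonical_embedding :: "'a::real_normed_vector \<Rightarrow> 'a dual dual"
  is "\<lambda>x \<phi>. blinfun_apply \<phi> x"
  by (rule blinfun.bounded_linear_left)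

text \<open>
  For scalar-valued operators the strong operator topology is the topology of pointwise convergence
  on functionals; on the bidual \<open>'a dual dual\<close> it is \<open>\<sigma>(E\<^sup>*\<^sup>*, E\<^sup>*)\<close>.
\<close>

abbreviation weak_star_topology :: "('a::real_normed_vector dual) topology" where
  "weak_star_topology \<equiv> strong_operator_topology"

lemma limitin_weak_star_topology:
  fixes f :: "'i \<Rightarrow> 'a::real_normed_vector dual"
  shows "limitin weak_star_topology f l F \<longleftrightarrow>
           (\<forall>x. ((\<lambda>i. blinfun_apply (f i) x) \<longlongrightarrow> blinfun_apply l x) F)"
proof
  assume "limitin weak_star_topology f l F"
  from continuous_map_limit[OF strong_operator_topology_continuous_evaluation this]
  show "\<forall>x. ((\<lambda>i. blinfun_apply (f i) x) \<longlongrightarrow> blinfun_apply l x) F"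
    by (simp add: o_def)
next
  assume "\<forall>x. ((\<lambda>i. blinfun_apply (f i) x) \<longlongrightarrow> blinfun_apply l x) F"
  then have "limitin (product_topology (\<lambda>_. euclidean) UNIV)
               (\<lambda>i. blinfun_apply (f i)) (blinfun_apply l) F"
    by (simp add: limitin_componentwise)
  then have lim: "limitin euclidean (\<lambda>i. blinfun_apply (f i)) (blinfun_apply l) F"
    by (simp only: euclidean_product_topology)
  show "limitin weak_star_topology f l F"
    unfolding limitin_def strong_operator_topology_def openin_pullback_topology
    using lim by (auto simp: limitin_def topspace_pullback_topology)
qed

definition weak_l1_complete :: "nat filter \<Rightarrow> bool" where
  "weak_l1_complete F \<longleftrightarrow>
     (\<forall>(x :: nat \<Rightarrow> l1) (\<xi> :: l1 dual dual).
        bounded (range x) \<and> limitin weak_star_topology (\<lambda>n. canonical_embedding (x n)) \<xi> F \<longrightarrow>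
        \<xi> \<in> range canonical_embedding)"

end

theory Submission
  imports Defs
begin

text \<open>
  Let \<open>y\<close> be the coordinatewise limit of the sequence; it lies in \<open>\<ell>\<^sub>1\<close>, and \<open>z\<^sub>n = x\<^sub>n - y\<close> tends to
  \<open>0\<close> in each coordinate along the filter. The diagonal and block-respecting properties turn the gliding
  hump argument into one that selects a stationary set \<open>K\<close> on which the \<open>z\<^sub>n\<close> are, up to \<open>\<epsilon>\<close> in norm,
  disjointly supported. As the trace on \<open>K\<close> is not an ultrafilter, \<open>K\<close> splits into two stationary
  sets \<open>B\<close> and \<open>K - B\<close>. For a functional \<open>\<phi>\<close>, the functional that agrees with \<open>\<phi>\<close> on the supports
  indexed by \<open>B\<close> and vanishes elsewhere is close to \<open>\<phi> z\<^sub>n\<close> for \<open>n\<close> in \<open>B\<close> and close to \<open>0\<close> for \<open>n\<close> in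
  \<open>K - B\<close>. Since it has a limit along the filter, the limit of \<open>\<phi> z\<^sub>n\<close> is \<open>0\<close>.
\<close>

section \<open>Stationary sets\<close>

lemma stationary_iff_frequently: "I \<in> stationary F \<longleftrightarrow> (\<exists>\<^sub>F n in F. n \<in> I)"
proof -
  have "I \<notin> stationary F \<longleftrightarrow> (\<exists>A\<in>filter_sets F. A \<subseteq> - I)"
    by (auto simp: stationary_def)
  also have "\<dots> \<longleftrightarrow> (\<forall>\<^sub>F n in F. n \<notin> I)"
    by (auto simp: filter_sets_def elim: eventually_mono intro!: exI[of _ "- I"])
  finally show ?thesis
    by (auto simp: frequently_def)
qed

lemma stationary_UnD:
  assumes "I \<union> J \<in> stationary F"
  shows "I \<in> stationary F \<or> J \<in> stationary F"
  using assms by (simp add: stationary_iff_frequently frequently_disj_iff)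

lemma infinite_stationary:
  assumes "free_filter F" "I \<in> stationary F"
  shows "infinite I"
proof
  assume "finite I"
  then have "- I \<in> filter_sets F" using assms(1) by (simp add: free_filter_def)
  with assms(2) show False by (auto simp: stationary_def)
qed

text \<open>A filter on \<open>K\<close> strictly finer than the trace has a member \<open>B\<close>
  outside the trace. As it contains the trace, \<open>B\<close> meets every set of \<open>F\<close>;
  as no trace set lies inside \<open>B\<close>, so does \<open>K - B\<close>.\<close>

lemma p_filter_split:
  assumes "p_filter F" "K \<in> stationary F"
  obtains B where "B \<subseteq> K" "B \<in> stationary F" "K - B \<in> stationary F"
proof -
  have tr: "filter_on K (trace_filter F K)"
    using assms(2) by (rule filter_on_trace_filter)
  then obtain H where H: "filter_on K H" "trace_filter F K \<subseteq> H" "H \<noteq> trace_filter F K"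
    using assms unfolding p_filter_def ultrafilter_on_def by blast
  then obtain B where B: "B \<in> H" "B \<notin> trace_filter F K" by blast
  have BK: "B \<subseteq> K" using B H(1) unfolding filter_on_def by blast
  have "B \<inter> A \<noteq> {}" if "A \<in> filter_sets F" for A
  proof -
    have "A \<inter> K \<in> H" using that H(2) unfolding trace_filter_def by blast
    then have "B \<inter> (A \<inter> K) \<in> H" "{} \<notin> H" using B(1) H(1) unfolding filter_on_def by blast+
    then show ?thesis by (metis inf_assoc inf_bot_left)
  qed
  then have "B \<in> stationary F" unfolding stationary_def by blast
  moreover have "(K - B) \<inter> A \<noteq> {}" if "A \<in> filter_sets F" for A
  proof
    assume "(K - B) \<inter> A = {}"
    then have "A \<inter> K \<subseteq> B" by blast
    moreover have "A \<inter> K \<in> trace_filter F K" using that unfolding trace_filter_def by blast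
    ultimately show False using tr BK B(2) unfolding filter_on_def by blast
  qed
  then have "K - B \<in> stationary F" unfolding stationary_def by blast
  ultimately show thesis using BK that by blast
qed

text \<open>One stationary set controls a limit along \<open>F\<close>: if
  \<open>e < \<bar>c\<bar>\<close>, then eventually \<open>e < \<bar>f n\<bar>\<close>, and the set
  of these \<open>n\<close> is in \<open>F\<close> but misses \<open>K\<close>.\<close>

lemma stationary_tendsto_bound:
  fixes f :: "nat \<Rightarrow> real"
  assumes "K \<in> stationary F" "(f \<longlongrightarrow> c) F" "\<And>n. n \<in> K \<Longrightarrow> \<bar>f n\<bar> \<le> e"
  shows "\<bar>c\<bar> \<le> e"
proof (rule ccontr)
  assume "\<not> \<bar>c\<bar> \<le> e"
  moreover have "((\<lambda>n. \<bar>f n\<bar>) \<longlongrightarrow> \<bar>c\<bar>) F" using assms(2) by (rule tendsto_rabs)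
  ultimately have "\<forall>\<^sub>F n in F. e < \<bar>f n\<bar>" by (intro order_tendstoD(1)) auto
  then have "\<forall>\<^sub>F n in F. n \<notin> K" by eventually_elim (use assms(3) in force)
  with assms(1) show False by (simp add: stationary_iff_frequently frequently_def)
qed

section \<open>Coordinate projections\<close>

lift_definition mask :: "nat set \<Rightarrow> l1 \<Rightarrow> l1" is "\<lambda>S f n. if n \<in> S then f n else 0"
  subgoal for S f
    by (rule summable_comparison_test'[of "\<lambda>n. \<bar>f n\<bar>" 0]) auto
  done

lemma norm_mask_subset:
  assumes "S \<subseteq> T"
  shows "norm (mask S x) \<le> norm (mask T x)"
  unfolding norm_l1.rep_eq
proof (rule suminf_le)
  show "\<bar>l1_nth (mask S x) n\<bar> \<le> \<bar>l1_nth (mask T x) n\<bar>" for n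
    using assms by (auto simp: mask.rep_eq)
qed (rule summable_l1_nth)+

lemma mask_UNIV [simp]: "mask UNIV x = x"
  by transfer simp

lemma mask_empty [simp]: "mask {} x = 0"
  by transfer simp

lemma mask_Un_disjoint: "S \<inter> T = {} \<Longrightarrow> mask (S \<union> T) x = mask S x + mask T x"
  by transfer (auto simp: fun_eq_iff)

lemma bounded_linear_mask: "bounded_linear (mask S)"
proof (rule bounded_linear_intro[where K = 1])
  show "norm (mask S x) \<le> norm x * 1" for x
    using norm_mask_subset[of S UNIV x] by simp
qed (transfer; auto simp: fun_eq_iff)+

lemma bounded_linear_l1_nth: "bounded_linear (\<lambda>x. l1_nth x j)"
  by (rule bounded_linear_intro[where K = 1])
    (auto simp: plus_l1.rep_eq scaleR_l1.rep_eq abs_l1_nth_le_norm)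

lemma norm_mask_lessThan: "norm (mask {..<m} x) = (\<Sum>j<m. \<bar>l1_nth x j\<bar>)"
proof -
  have "norm (mask {..<m} x) = (\<Sum>j<m. \<bar>l1_nth (mask {..<m} x) j\<bar>)"
    unfolding norm_l1.rep_eq by (rule suminf_finite) (auto simp: mask.rep_eq)
  then show ?thesis by (simp add: mask.rep_eq)
qed

text \<open>The norms of head and tail add up to \<open>norm x\<close>, and the head norms are the
  partial sums of its series.\<close>

lemma norm_mask_atLeast_tendsto_0: "(\<lambda>m. norm (mask {m..} x)) \<longlonglongrightarrow> 0"
proof -
  have "norm (mask {m..} x) = norm x - (\<Sum>j<m. \<bar>l1_nth x j\<bar>)" for m
  proof -
    have "norm x = (\<Sum>n. \<bar>l1_nth (mask {..<m} x) n\<bar> + \<bar>l1_nth (mask {m..} x) n\<bar>)"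
      unfolding norm_l1.rep_eq by (rule suminf_cong) (simp add: mask.rep_eq)
    also have "\<dots> = norm (mask {..<m} x) + norm (mask {m..} x)"
      unfolding norm_l1.rep_eq by (rule suminf_add[symmetric]) (rule summable_l1_nth)+
    finally show ?thesis by (simp add: norm_mask_lessThan)
  qed
  moreover have "(\<lambda>m. norm x - (\<Sum>j<m. \<bar>l1_nth x j\<bar>)) \<longlonglongrightarrow> norm x - norm x"
    unfolding norm_l1.rep_eq
    by (intro tendsto_diff tendsto_const summable_LIMSEQ summable_l1_nth)
  ultimately show ?thesis by simp
qed

section \<open>The gliding hump\<close>

text \<open>
  An element of the block \<open>D k\<close> is small outside the window \<open>{Q (f (k - 1))..<Q (f (k + 1))}\<close>; windows
  of blocks whose indices have the same parity are disjoint.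
\<close>

lemma almost_disjoint_supports:
  fixes z :: "nat \<Rightarrow> l1"
  assumes "F \<noteq> bot" "free_filter F" "diagonal_filter F" "block_respecting F"
    and z: "\<And>j. ((\<lambda>n. l1_nth (z n) j) \<longlongrightarrow> 0) F" and "0 < \<epsilon>"
  obtains K I where "K \<in> stationary F" "disjoint_family_on I K"
    "\<forall>n\<in>K. norm (mask (- I n) (z n)) < \<epsilon>"
proof -
  \<comment> \<open>The complement of a window is a head and a tail; each is allowed half of
    \<open>\<epsilon>\<close>.\<close>
  define e where "e = \<epsilon> / 2"
  have e: "0 < e" using \<open>0 < \<epsilon>\<close> by (simp add: e_def)
  \<comment> \<open>These indices have a small head of length \<open>m\<close>. They form a set in
    \<open>F\<close>, as only finitely many coordinates are involved; the diagonal property yields a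
    stationary \<open>J\<close> in which, for each \<open>m\<close>, only finitely many indices
    violate this.\<close>
  define A where "A m = {n. norm (mask {..<m} (z n)) < e}" for m
  have "decseq A"
    unfolding decseq_def A_def using norm_mask_subset[of "{..<_}" "{..<_}"]
    by (auto intro: le_less_trans)
  moreover have "A m \<in> filter_sets F" for m
  proof -
    have "((\<lambda>n. \<Sum>j<m. \<bar>l1_nth (z n) j\<bar>) \<longlongrightarrow> (\<Sum>j<m. \<bar>0\<bar>)) F"
      by (intro tendsto_intros z)
    then show ?thesis
      unfolding filter_sets_def A_def norm_mask_lessThan
      using e by (auto intro: order_tendstoD(2))
  qed
  moreover have "UNIV \<in> stationary F"
    using assms(1) by (simp add: stationary_iff_frequently frequently_def trivial_limit_def)
  ultimately obtain J where J: "J \<in> stationary F" and JA: "\<And>m. finite (J - A m)"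
    using assms(3) unfolding diagonal_filter_def by blast
  have infJ: "infinite J" using assms(2) J by (rule infinite_stationary)
  have "\<exists>q. norm (mask {q..} (z n)) < e" for n
    using order_tendstoD(2)[OF norm_mask_atLeast_tendsto_0 e]
    by (auto simp: eventually_sequentially)
  then obtain q where q: "\<And>n. norm (mask {q n..} (z n)) < e" by metis
  \<comment> \<open>Summation makes \<open>Q\<close> monotone and lets the single cut-off
    \<open>Q m\<close> serve the tails of all \<open>z n\<close> with \<open>n < m\<close>.\<close>
  define Q where "Q m = (\<Sum>n<m. q n)" for m
  have Q_mono: "Q m \<le> Q m'" if "m \<le> m'" for m m'
    unfolding Q_def using that by (intro sum_mono2) auto
  have Q: "norm (mask {Q m..} (z n)) < e" if "n < m" for n m
  proof -
    have "q n \<le> Q m" unfolding Q_def using that by (intro member_le_sum) auto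
    then show ?thesis
      using norm_mask_subset[of "{Q m..}" "{q n..}" "z n"] q[of n] by force
  qed
  \<comment> \<open>\<open>N\<close> lies beyond an element of \<open>J\<close> from
    \<open>m\<close> on, which makes the block nonempty, and beyond the finite exceptional set
    \<open>J - A (Q m)\<close>.\<close>
  have "\<exists>N>m. J \<inter> {m..<N} \<noteq> {} \<and> (\<forall>n\<in>J. N \<le> n \<longrightarrow> n \<in> A (Q m))" for m
  proof -
    obtain b where b: "\<And>n. n \<in> J - A (Q m) \<Longrightarrow> n < b"
      using JA[of "Q m"] by (auto simp only: finite_nat_set_iff_bounded)
    obtain a where a: "a \<in> J" "m \<le> a"
      using infJ unfolding infinite_nat_iff_unbounded_le by auto
    define N where "N = Suc (max a b)"
    have "m < N" "a \<in> J \<inter> {m..<N}" using a by (auto simp: N_def)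
    moreover have "n \<in> A (Q m)" if "n \<in> J" "N \<le> n" for n
      using b[of n] that by (fastforce simp: N_def)
    ultimately show ?thesis by (intro exI[of _ N]) auto
  qed
  then obtain g where g: "\<And>m. m < g m" "\<And>m. J \<inter> {m..<g m} \<noteq> {}"
    "\<And>m n. n \<in> J \<Longrightarrow> g m \<le> n \<Longrightarrow> n \<in> A (Q m)"
    by metis
  \<comment> \<open>At the cut-off \<open>Q (f k)\<close>, tails are small for
    \<open>n < f k\<close>, and heads are small for \<open>n\<close> in \<open>J\<close> with
    \<open>f (Suc k) \<le> n\<close>. Only indices in block \<open>k\<close> escape both.\<close>
  define f where "f k = (g ^^ k) 0" for k
  have f_Suc: "f (Suc k) = g (f k)" and f_0: "f 0 = 0" for k
    by (simp_all add: f_def)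
  have "strict_mono f" by (simp add: strict_mono_Suc_iff f_Suc g(1))
  then have f_mono: "f k \<le> f l" if "k \<le> l" for k l
    using that by (simp add: strict_mono_less_eq)
  define D where "D k = J \<inter> {f k..<f (Suc k)}" for k
  have D_unique: "k = l" if "n \<in> D k" "n \<in> D l" for n k l
  proof -
    have "f k < f (Suc l)" "f l < f (Suc k)" using that by (auto simp: D_def)
    then show ?thesis
      using \<open>strict_mono f\<close> by (simp add: strict_mono_less)
  qed
  have D_cover: "\<exists>k. n \<in> D k" if "n \<in> J" for n
  proof -
    define k where "k = (LEAST k. n < f (Suc k))"
    have "n < f (Suc n)"
      using strict_mono_imp_increasing[OF \<open>strict_mono f\<close>, of "Suc n"] by simp
    then have k: "n < f (Suc k)" unfolding k_def by (rule LeastI)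
    have "f k \<le> n"
    proof (cases k)
      case (Suc l)
      then show ?thesis using not_less_Least[of l "\<lambda>k. n < f (Suc k)"] by (simp add: k_def)
    qed (simp add: f_0)
    with k that show ?thesis by (auto simp: D_def)
  qed
  have "blocking J D"
    unfolding blocking_def disjoint_family_on_def
    using infJ D_cover g(2) D_unique by (auto simp: D_def f_Suc)
  then obtain J' where J': "J' \<in> stationary F" "J' \<subseteq> J" and card: "\<And>k. card (J' \<inter> D k) = 1"
    using assms(4) J unfolding block_respecting_def by blast
  have J'_unique: "n = n'" if "n \<in> J' \<inter> D k" "n' \<in> J' \<inter> D k" for n n' k
    using card[of k] that by (metis card_1_singletonE singletonD)
  obtain \<kappa> where \<kappa>: "\<And>n. n \<in> J \<Longrightarrow> n \<in> D (\<kappa> n)" using D_cover by metis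
  \<comment> \<open>Windows of neighbouring blocks may overlap. Block indices of equal parity differ
    by at least 2, which separates the windows, and one parity class stays stationary.\<close>
  have "{n \<in> J'. even (\<kappa> n)} \<union> {n \<in> J'. odd (\<kappa> n)} = J'" by blast
  then have "{n \<in> J'. even (\<kappa> n)} \<in> stationary F \<or> {n \<in> J'. odd (\<kappa> n)} \<in> stationary F"
    using J'(1) by (intro stationary_UnD) simp
  then obtain P :: "nat \<Rightarrow> bool"
    where K: "{n \<in> J'. P (\<kappa> n)} \<in> stationary F" and P: "P = even \<or> P = odd"
    using that[of even] that[of odd] by (elim disjE) simp_all
  \<comment> \<open>In block 0 truncated subtraction puts the lower end at
    \<open>Q (f 0) = 0\<close>, so the head is empty.\<close>
  define I where "I n = {Q (f (\<kappa> n - 1))..<Q (f (Suc (\<kappa> n)))}" for n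
  show thesis
  proof
    have aux: "I n \<inter> I n' = {}" if "n \<in> J'" "n' \<in> J'" "P (\<kappa> n)" "P (\<kappa> n')" "\<kappa> n < \<kappa> n'" for n n'
    proof -
      have "even (\<kappa> n) = even (\<kappa> n')" using P that by auto
      then have "Suc (\<kappa> n) \<le> \<kappa> n' - 1" using \<open>\<kappa> n < \<kappa> n'\<close> by presburger
      then have "Q (f (Suc (\<kappa> n))) \<le> Q (f (\<kappa> n' - 1))" by (intro Q_mono f_mono)
      then show ?thesis by (auto simp: I_def)
    qed
    show "disjoint_family_on I {n \<in> J'. P (\<kappa> n)}"
      unfolding disjoint_family_on_def
    proof (intro ballI impI)
      fix n n' assume n: "n \<in> {n \<in> J'. P (\<kappa> n)}" "n' \<in> {n \<in> J'. P (\<kappa> n)}" "n \<noteq> n'"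
      then have "\<kappa> n \<noteq> \<kappa> n'" using J'_unique \<kappa> J'(2) by (metis (lifting) IntI mem_Collect_eq subsetD)
      then show "I n \<inter> I n' = {}" using aux[of n n'] aux[of n' n] n by (auto simp: neq_iff)
    qed
    show "\<forall>n\<in>{n \<in> J'. P (\<kappa> n)}. norm (mask (- I n) (z n)) < \<epsilon>"
    proof
      fix n assume nK: "n \<in> {n \<in> J'. P (\<kappa> n)}"
      let ?a = "Q (f (\<kappa> n - 1))" and ?b = "Q (f (Suc (\<kappa> n)))"
      have nJ: "n \<in> J" and n: "f (\<kappa> n) \<le> n" "n < f (Suc (\<kappa> n))"
        using nK J'(2) \<kappa>[of n] by (auto simp: D_def)
      have "norm (mask {..<?a} (z n)) < e"
      proof (cases "\<kappa> n")
        case 0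
        then show ?thesis using e by (simp add: f_0 Q_def)
      next
        case (Suc k)
        then show ?thesis using g(3)[OF nJ, of "f k"] n by (simp add: f_Suc A_def)
      qed
      moreover have "norm (mask {?b..} (z n)) < e" using n(2) by (rule Q)
      moreover have "?a \<le> ?b" by (intro Q_mono f_mono) simp
      then have "- I n = {..<?a} \<union> {?b..}" "{..<?a} \<inter> {?b..} = {}" by (auto simp: I_def)
      then have "norm (mask (- I n) (z n)) \<le> norm (mask {..<?a} (z n)) + norm (mask {?b..} (z n))"
        by (simp add: mask_Un_disjoint norm_triangle_ineq)
      ultimately show "norm (mask (- I n) (z n)) < \<epsilon>" by (simp add: e_def)
    qed
  qed (fact K)
qed

lemma weak_limit_eq_0:
  fixes z :: "nat \<Rightarrow> l1" and \<zeta> :: "l1 dual \<Rightarrow> real"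
  assumes "F \<noteq> bot" "free_filter F" "p_filter F" "diagonal_filter F" "block_respecting F"
    and coord: "\<And>j. ((\<lambda>n. l1_nth (z n) j) \<longlongrightarrow> 0) F"
    and lim: "\<And>\<phi>. ((\<lambda>n. blinfun_apply \<phi> (z n)) \<longlongrightarrow> \<zeta> \<phi>) F"
  shows "\<zeta> \<phi> = 0"
proof -
  have bound: "\<bar>\<zeta> \<phi>\<bar> \<le> 2 * norm \<phi> * \<epsilon>" if "0 < \<epsilon>" for \<epsilon>
  proof -
    obtain K I where K: "K \<in> stationary F" and I: "disjoint_family_on I K"
      and small: "\<forall>n\<in>K. norm (mask (- I n) (z n)) < \<epsilon>"
      using almost_disjoint_supports[OF assms(1,2,4,5) coord \<open>0 < \<epsilon>\<close>] .
    obtain B where B: "B \<subseteq> K" "B \<in> stationary F" "K - B \<in> stationary F"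
      using p_filter_split[OF assms(3) K] .
    define S where "S = (\<Union>n\<in>B. I n)"
    \<comment> \<open>Being a functional, \<open>\<psi>\<close> has its own limit along
      \<open>F\<close>, which can be tested on \<open>B\<close> and on \<open>K - B\<close>
      alike.\<close>
    define \<psi> where "\<psi> = \<phi> o\<^sub>L Blinfun (mask S)"
    have \<psi>: "blinfun_apply \<psi> x = blinfun_apply \<phi> (mask S x)" for x
      by (simp add: \<psi>_def bounded_linear_Blinfun_apply bounded_linear_mask)
    have \<phi>_bound: "\<bar>blinfun_apply \<phi> (mask T (z n))\<bar> \<le> norm \<phi> * \<epsilon>" if "n \<in> K" "T \<subseteq> - I n" for T n
    proof -
      have "\<bar>blinfun_apply \<phi> (mask T (z n))\<bar> \<le> norm \<phi> * norm (mask T (z n))"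
        using norm_blinfun[of \<phi> "mask T (z n)"] by simp
      also have "\<dots> \<le> norm \<phi> * \<epsilon>"
        using norm_mask_subset[OF that(2), of "z n"] bspec[OF small that(1)]
        by (intro mult_left_mono) auto
      finally show ?thesis .
    qed
    \<comment> \<open>On \<open>B\<close> the two functionals differ only by what
      \<open>\<phi>\<close> sees outside \<open>S\<close>, hence outside \<open>I n\<close>.\<close>
    have "\<bar>\<zeta> \<phi> - \<zeta> \<psi>\<bar> \<le> norm \<phi> * \<epsilon>"
    proof (rule stationary_tendsto_bound[OF B(2) tendsto_diff[OF lim lim]])
      fix n assume n: "n \<in> B"
      have "mask S (z n) + mask (- S) (z n) = z n"
        by (subst mask_Un_disjoint[symmetric]) auto
      from arg_cong[OF this, of "blinfun_apply \<phi>"]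
      have "blinfun_apply \<phi> (z n) - blinfun_apply \<psi> (z n) = blinfun_apply \<phi> (mask (- S) (z n))"
        unfolding \<psi> blinfun.add_right by linarith
      moreover have "- S \<subseteq> - I n" using n by (auto simp: S_def)
      ultimately show "\<bar>blinfun_apply \<phi> (z n) - blinfun_apply \<psi> (z n)\<bar> \<le> norm \<phi> * \<epsilon>"
        using \<phi>_bound[of n "- S"] n B(1) by auto
    qed
    \<comment> \<open>On \<open>K - B\<close> the set \<open>S\<close> misses the window
      \<open>I n\<close>, so \<open>\<psi>\<close> sees only the small part of
      \<open>z n\<close>.\<close>
    moreover have "\<bar>\<zeta> \<psi>\<bar> \<le> norm \<phi> * \<epsilon>"
    proof (rule stationary_tendsto_bound[OF B(3) lim])
      fix n assume n: "n \<in> K - B"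
      have "I m \<inter> I n = {}" if "m \<in> B" for m
        using n B(1) that by (intro disjoint_family_onD[OF I]) auto
      then have "S \<subseteq> - I n" by (auto simp: S_def)
      then show "\<bar>blinfun_apply \<psi> (z n)\<bar> \<le> norm \<phi> * \<epsilon>"
        using \<phi>_bound[of n S] n by (simp add: \<psi>)
    qed
    ultimately show ?thesis by linarith
  qed
  have "((\<lambda>\<epsilon>. 2 * norm \<phi> * \<epsilon>) \<longlongrightarrow> 2 * norm \<phi> * 0) (at_right 0)"
    by (intro tendsto_intros)
  moreover have "\<forall>\<^sub>F \<epsilon> in at_right 0. \<bar>\<zeta> \<phi>\<bar> \<le> 2 * norm \<phi> * \<epsilon>"
    by (rule eventually_at_rightI[of 0 1]) (simp_all add: bound)
  ultimately have "\<bar>\<zeta> \<phi>\<bar> \<le> 2 * norm \<phi> * 0"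
    by (rule tendsto_lowerbound) simp
  then show ?thesis by simp
qed

theorem theorem5p5:
  fixes F :: "nat filter"
  assumes "F \<noteq> bot"
    and "free_filter F"
    and "p_filter F"
    and "diagonal_filter F"
    and "block_respecting F"
  shows "weak_l1_complete F"
  unfolding weak_l1_complete_def
proof (intro allI impI, elim conjE)
  fix x :: "nat \<Rightarrow> l1" and \<xi> :: "l1 dual dual"
  assume "bounded (range x)"
    and "limitin weak_star_topology (\<lambda>n. canonical_embedding (x n)) \<xi> F"
  then obtain C where C: "\<And>n. norm (x n) \<le> C"
    and lim: "\<And>\<phi>. ((\<lambda>n. blinfun_apply \<phi> (x n)) \<longlongrightarrow> blinfun_apply \<xi> \<phi>) F"
    by (auto simp: bounded_iff limitin_weak_star_topology canonical_embedding.rep_eq)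
  \<comment> \<open>The only candidate for the limit in \<open>l1\<close>: the values of
    \<open>\<xi>\<close> at the coordinate functionals.\<close>
  define y where "y j = blinfun_apply \<xi> (Blinfun (\<lambda>x. l1_nth x j))" for j
  have y: "((\<lambda>n. l1_nth (x n) j) \<longlongrightarrow> y j) F" for j
    using lim[of "Blinfun (\<lambda>x. l1_nth x j)"]
    by (simp add: y_def bounded_linear_Blinfun_apply bounded_linear_l1_nth)
  \<comment> \<open>The norm bound passes to the limit in each finite partial sum, which gives
    summability of \<open>y\<close>.\<close>
  have "(\<Sum>j<N. \<bar>y j\<bar>) \<le> C" for N
  proof (rule tendsto_upperbound)
    show "((\<lambda>n. \<Sum>j<N. \<bar>l1_nth (x n) j\<bar>) \<longlongrightarrow> (\<Sum>j<N. \<bar>y j\<bar>)) F"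
      by (intro tendsto_intros y)
    show "\<forall>\<^sub>F n in F. (\<Sum>j<N. \<bar>l1_nth (x n) j\<bar>) \<le> C"
      using sum_abs_l1_nth_le_norm C by (intro always_eventually allI) (rule order_trans)
  qed (use assms(1) in simp)
  then have "summable (\<lambda>j. \<bar>y j\<bar>)"
    by (intro summableI_nonneg_bounded) auto
  then have L: "l1_nth (Abs_l1 y) = y" by (simp add: Abs_l1_inverse)
  \<comment> \<open>Here \<open>\<zeta>\<close> is the defect between \<open>\<xi>\<close> and the
    embedded \<open>y\<close>, so its vanishing identifies them.\<close>
  have "blinfun_apply \<xi> \<phi> - blinfun_apply \<phi> (Abs_l1 y) = 0" for \<phi>
  proof (rule weak_limit_eq_0[OF assms, where z = "\<lambda>n. x n - Abs_l1 y"])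
    show "((\<lambda>n. l1_nth (x n - Abs_l1 y) j) \<longlongrightarrow> 0) F" for j
      using tendsto_diff[OF y[of j] tendsto_const[of "y j"]] by (simp add: minus_l1.rep_eq L)
    show "((\<lambda>n. blinfun_apply \<phi> (x n - Abs_l1 y))
            \<longlongrightarrow> blinfun_apply \<xi> \<phi> - blinfun_apply \<phi> (Abs_l1 y)) F" for \<phi>
      unfolding blinfun.diff_right by (intro tendsto_diff lim tendsto_const)
  qed
  then have "\<xi> = canonical_embedding (Abs_l1 y)"
    by (intro blinfun_eqI) (simp add: canonical_embedding.rep_eq)
  then show "\<xi> \<in> range canonical_embedding" by blast
qed

end
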